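(* Let $\mathcal{R}\colon\mathcal{H}_d\to\mathcal{H}_d$ be an $\mathbb{R}$-linear map on the dual quaternion algebra. Then $\mathcal{R}$ is a Rota-Baxter operator of weight $0$ on $\mathcal{H}_d$ if and only if its matrix $R$ with respect to the basis $\{e_0,e_1,e_2,e_3\}$ has the form $$R=\begin{pmatrix}0&\mathbf{0}^T\\ \mathbf{b}&A\end{pmatrix},\qquad A^2=0,\quad A\mathbf{b}=0,$$ where $A$ is a real $3\times3$ matrix and $\mathbf{b}=(b_1,b_2,b_3)^T\in\mathbb{R}^3$.
   Context: The dual quaternion algebra $\mathcal{H}_d$ is the 4-dimensional commutative associative unital $\mathbb{R}$-algebra with basis $e_0,e_1,e_2,e_3$, where $e_0$ is the identity and $e_ie_j=0$ for all $i,j\in\{1,2,3\}$; that is, $x\cdot y=x_0y_0e_0+\sum_{i=1}^3(x_0y_i+y_0x_i)e_i$ for $x=\sum_{i=0}^3 x_ie_i$, $y=\sum_{i=0}^3 y_ie_i$. For $\lambda\in\mathbb{R}$, a Rota-Baxter operator of weight $\lambda$ on an $\mathbb{R}$-algebra $B$ is an $\mathbb{R}$-linear map $\mathcal{R}\colon B\to B$ such that $\mathcal{R}(x)\mathcal{R}(y)=\mathcal{R}(\mathcal{R}(x)y)+\mathcal{R}(x\mathcal{R}(y))+\lambda\mathcal{R}(xy)$ for all $x,y\in B$. The matrix $R$ of $\mathcal{R}$ is the $4\times 4$ real matrix whose columns are, in order, the coordinate vectors of $\mathcal{R}(e_0),\mathcal{R}(e_1),\mathcal{R}(e_2),\mathcal{R}(e_3)$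 in the basis $\{e_0,e_1,e_2,e_3\}$. $\mathbf{0}$ denotes the zero column vector in $\mathbb{R}^3$. *)

theory Defs
  imports "HOL-Analysis.Analysis"
begin

text \<open>
  An element is given by its four coordinates with respect to \<open>e\<^sub>0, \<dots>, e\<^sub>3\<close>.  The index type
  \<^typ>\<open>4\<close> has exactly the elements \<open>0, 1, 2, 3\<close> (and \<open>4 = 0\<close>), so the coordinate of \<open>e\<^sub>i\<close> is the one
  at index \<open>i\<close>.  A new type is used because \<^typ>\<open>real ^ 4\<close> already carries the componentwise product.
\<close>

typedef dual_quaternion = "UNIV :: (real ^ 4) set"
  morphisms coords of_coords
  by simp

setup_lifting type_definition_dual_quaternion

instantiation dual_quaternion :: "{comm_ring_1, real_algebra_1}"
begin

lift_definition zero_dual_quaternion :: dual_quaternion is "0" .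
lift_definition one_dual_quaternion :: dual_quaternion is "axis 0 1" .
lift_definition plus_dual_quaternion :: "dual_quaternion \<Rightarrow> dual_quaternion \<Rightarrow> dual_quaternion"
  is "(+)" .
lift_definition minus_dual_quaternion :: "dual_quaternion \<Rightarrow> dual_quaternion \<Rightarrow> dual_quaternion"
  is "(-)" .
lift_definition uminus_dual_quaternion :: "dual_quaternion \<Rightarrow> dual_quaternion"
  is "uminus" .
lift_definition scaleR_dual_quaternion :: "real \<Rightarrow> dual_quaternion \<Rightarrow> dual_quaternion"
  is "scaleR" .
lift_definition times_dual_quaternion :: "dual_quaternion \<Rightarrow> dual_quaternion \<Rightarrow> dual_quaternion"
  is "\<lambda>x y. \<chi> i. if i = 0 then x $ 0 * y $ 0 else x $ 0 * y $ i + y $ 0 * x $ i" .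

instance
  by standard (transfer; auto simp: vec_eq_iff axis_def algebra_simps)+

end

definition dq_basis :: "4 \<Rightarrow> dual_quaternion"
  where "dq_basis i = of_coords (axis i 1)"

lemma coords_dq_basis [simp]: "coords (dq_basis i) = axis i 1"
  by (simp add: dq_basis_def of_coords_inverse)

lemma dq_basis_0: "dq_basis 0 = 1"
  by (simp add: dq_basis_def one_dual_quaternion_def)

lemma dq_basis_mult: "i \<noteq> 0 \<Longrightarrow> j \<noteq> 0 \<Longrightarrow> dq_basis i * dq_basis j = 0"
  unfolding dq_basis_def by transfer (auto simp: vec_eq_iff axis_def)

lemma dq_basis_expansion: "x = (\<Sum>i\<in>UNIV. (coords x $ i) *\<^sub>R dq_basis i)"
proof -
  have *: "coords (sum f S) = (\<Sum>i\<in>S. coords (f i))" if "finite S"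
    for f :: "4 \<Rightarrow> dual_quaternion" and S
    using that by (induction S) (auto simp: zero_dual_quaternion.rep_eq plus_dual_quaternion.rep_eq)
  have "coords x = coords (\<Sum>i\<in>UNIV. (coords x $ i) *\<^sub>R dq_basis i)"
    by (simp add: * scaleR_dual_quaternion.rep_eq basis_expansion
        flip: scalar_mult_eq_scaleR)
  then show ?thesis by (simp add: coords_inject)
qed

definition rota_baxter_operator :: "real \<Rightarrow> ('a::real_algebra \<Rightarrow> 'a) \<Rightarrow> bool"
  where "rota_baxter_operator w R \<longleftrightarrow> linear R \<and>
    (\<forall>x y. R x * R y = R (R x * y) + R (x * R y) + w *\<^sub>R R (x * y))"

definition dq_matrix :: "(dual_quaternion \<Rightarrow> dual_quaternion) \<Rightarrow> real ^ 4 ^ 4"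
  where "dq_matrix R = (\<chi> i j. coords (R (dq_basis j)) $ i)"

text \<open>
  The index type \<^typ>\<open>3\<close> of the vector \<open>b\<close> and the matrix \<open>A\<close> has the elements \<open>1, 2, 3\<close> (with \<open>3 = 0\<close>);
  the nonzero elements \<open>1, 2, 3\<close> of \<^typ>\<open>4\<close> are identified with them in this order.  The value of
  \<open>imag_index\<close> at \<open>0\<close> is irrelevant.
\<close>

definition imag_index :: "4 \<Rightarrow> 3"
  where "imag_index i = (if i = 1 then 1 else if i = 2 then 2 else 3)"

definition block_matrix :: "real ^ 3 \<Rightarrow> real ^ 3 ^ 3 \<Rightarrow> real ^ 4 ^ 4"
  where "block_matrix b A = (\<chi> i j.
    if i = 0 then 0
    else if j = 0 then b $ imag_index i
    else A $ imag_index i $ imag_index j)"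

end

theory Submission imports Defs begin

text \<open>
  Writing \<open>re x\<close> for the coordinate at \<open>e\<^sub>0\<close>, the product is
  \<open>x y = re x y + re y x - re x re y e\<^sub>0\<close>.  Hence a linear \<open>R\<close> is a Rota-Baxter operator of weight 0
  iff \<open>re \<circ> R = 0\<close> and \<open>R \<circ> R = 0\<close>: for imaginary \<open>x\<close>, the identity at \<open>(x, x)\<close> gives
  \<open>(re (R x))\<^sup>2 = 0\<close>; the identity at \<open>(e\<^sub>0, e\<^sub>0)\<close> then gives \<open>re (R e\<^sub>0) = 0\<close>; and the identity at
  \<open>(x, e\<^sub>0)\<close> becomes \<open>R (R x) = - re x R (R e\<^sub>0)\<close>, which at \<open>x = e\<^sub>0\<close> forces \<open>R (R e\<^sub>0) = 0\<close>.
  In matrix terms this says that the first row vanishes and that the matrix squares to zero.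
\<close>

definition dq_re :: "dual_quaternion \<Rightarrow> real"
  where "dq_re x = coords x $ 0"

lemma dq_re_one [simp]: "dq_re 1 = 1"
  unfolding dq_re_def by transfer (simp add: axis_def)

lemma linear_coords: "linear coords"
  by (rule linearI) (simp_all add: plus_dual_quaternion.rep_eq scaleR_dual_quaternion.rep_eq)

lemma linear_dq_re: "linear dq_re"
  by (rule linearI)
    (simp_all add: dq_re_def plus_dual_quaternion.rep_eq scaleR_dual_quaternion.rep_eq)

text \<open>At \<open>e_0\<close> each of the first two terms already gives the full product of the
  real parts, so one copy is subtracted; elsewhere \<open>1\<close> has coordinate zero.\<close>

lemma dq_mult_eq:
  "x * y = dq_re x *\<^sub>R y + dq_re y *\<^sub>R x - (dq_re x * dq_re y) *\<^sub>R 1"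
  unfolding dq_re_def by transfer (simp add: vec_eq_iff axis_def)

lemma rota_baxter_0_imp_dq_re_eq_0:
  assumes "rota_baxter_operator 0 R"
  shows "dq_re (R x) = 0"
proof -
  interpret R: linear R using assms by (simp add: rota_baxter_operator_def)
  interpret re: linear dq_re by (rule linear_dq_re)
  have RB: "R x * R y = R (R x * y) + R (x * R y)" for x y
    using assms by (simp add: rota_baxter_operator_def)
  have imag: "dq_re (R x) = 0" if "dq_re x = 0" for x
  proof -
    \<comment> \<open>Both sides of the identity contain \<open>2 * dq_re (R x)\<close> times
      \<open>R x\<close>; cancelling leaves only the multiple of \<open>1\<close>.\<close>
    have "(dq_re (R x) * dq_re (R x)) *\<^sub>R (1 :: dual_quaternion) = 0"
      using RB[of x x] that by (simp add: dq_mult_eq R.scale)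
    then show ?thesis by simp
  qed
  have re_R: "dq_re (R x) = dq_re x * dq_re (R 1)" for x
    using imag[of "x - dq_re x *\<^sub>R 1"] by (simp add: R.diff R.scale re.diff re.scale)
  \<comment> \<open>With \<open>r = dq_re (R 1)\<close>, the left side is \<open>r * r\<close> and,
    by \<open>re_R\<close>, the right side is \<open>2 * r * r\<close>.\<close>
  have "dq_re (R 1 * R 1) = dq_re (R (R 1) + R (R 1))"
    using RB[of 1 1] by simp
  then have "dq_re (R 1) = 0"
    by (simp add: dq_mult_eq re.add re.diff re.scale re_R[of "R 1"])
  then show ?thesis by (subst re_R) simp
qed

lemma rota_baxter_0_iff:
  assumes "linear R"
  shows "rota_baxter_operator 0 R \<longleftrightarrow> (\<forall>x. dq_re (R x) = 0) \<and> (\<forall>x. R (R x) = 0)"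
proof -
  interpret R: linear R by (rule assms)
  have "R (R x) = 0" if RB: "rota_baxter_operator 0 R" for x
  proof -
    have re: "dq_re (R x) = 0" for x
      by (rule rota_baxter_0_imp_dq_re_eq_0[OF RB])
    have "R x * R 1 = R (R x) + R (x * R 1)" for x
      using RB unfolding rota_baxter_operator_def by (metis add_0_right mult_1_right scaleR_zero_left)
    \<comment> \<open>The product \<open>R x * R 1\<close> vanishes, both factors being
      imaginary.\<close>
    then have *: "R (R x) + dq_re x *\<^sub>R R (R 1) = 0" for x
      by (simp add: dq_mult_eq[of _ "R 1"] re R.scale)
    have "2 *\<^sub>R R (R 1) = 0"
      using *[of 1] by (simp add: scaleR_2)
    then show ?thesis using *[of x] by simp
  qed
  moreover have "rota_baxter_operator 0 R" if "\<forall>x. dq_re (R x) = 0" "\<forall>x. R (R x) = 0"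
    using that assms by (simp add: rota_baxter_operator_def dq_mult_eq R.scale)
  ultimately show ?thesis
    using rota_baxter_0_imp_dq_re_eq_0 by blast
qed

lemma coords_eq_dq_matrix_mult:
  assumes "linear R"
  shows "coords (R x) = dq_matrix R *v coords x"
proof -
  interpret R: linear R by (rule assms)
  interpret c: linear coords by (rule linear_coords)
  have "R x = (\<Sum>i\<in>UNIV. (coords x $ i) *\<^sub>R R (dq_basis i))"
    by (subst dq_basis_expansion[of x]) (simp add: R.sum R.scale)
  then show ?thesis
    by (simp add: c.sum c.scale vec_eq_iff matrix_vector_mult_def dq_matrix_def mult.commute)
qed

lemma surj_coords: "\<exists>x. coords x = v"
  using of_coords_inverse by blast

lemma dq_re_eq_0_iff_row:
  assumes "linear R"
  shows "(\<forall>x. dq_re (R x) = 0) \<longleftrightarrow> dq_matrix R $ 0 = 0"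
proof
  show "dq_matrix R $ 0 = 0" if "\<forall>x. dq_re (R x) = 0"
    using that by (simp add: dq_matrix_def vec_eq_iff dq_re_def)
  show "\<forall>x. dq_re (R x) = 0" if "dq_matrix R $ 0 = 0"
    using that by (simp add: dq_re_def coords_eq_dq_matrix_mult[OF assms] matrix_vector_mult_def)
qed

lemma square_eq_0_iff_matrix:
  assumes "linear R"
  shows "(\<forall>x. R (R x) = 0) \<longleftrightarrow> dq_matrix R ** dq_matrix R = 0"
proof -
  have "(\<forall>x. R (R x) = 0) \<longleftrightarrow> (\<forall>x. coords (R (R x)) = 0)"
    by (metis coords_inject zero_dual_quaternion.rep_eq)
  also have "\<dots> \<longleftrightarrow> (\<forall>v. (dq_matrix R ** dq_matrix R) *v v = 0)"
    using surj_coords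
    by (metis coords_eq_dq_matrix_mult[OF assms] matrix_vector_mul_assoc)
  also have "\<dots> \<longleftrightarrow> dq_matrix R ** dq_matrix R = 0"
    by (simp add: matrix_eq)
  finally show ?thesis .
qed

text \<open>\<open>forall_4\<close> and \<open>sum_4\<close> run over 1 to 4, so the real coordinate
  0 appears there as 4.\<close>

lemma numeral_4_eq_0: "(4 :: 4) = 0"
  using exhaust_4[of 0] by auto

lemma forall_4_from_0: "(\<forall>i::4. P i) \<longleftrightarrow> P 0 \<and> P 1 \<and> P 2 \<and> P 3"
  unfolding forall_4 numeral_4_eq_0 by auto

lemma sum_4_from_0: "sum f (UNIV :: 4 set) = f 0 + f 1 + f 2 + f 3"
  unfolding sum_4 numeral_4_eq_0 by (simp add: ac_simps)

lemma imag_index_simps [simp]: "imag_index 1 = 1" "imag_index 2 = 2" "imag_index 3 = 3"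
  by (simp_all add: imag_index_def)

text \<open>In the product the left factor's column \<open>b\<close> meets only the zero top row, so
  just the block \<open>A\<close> acts.\<close>

lemma block_matrix_mult: "block_matrix b A ** block_matrix b A = block_matrix (A *v b) (A ** A)"
  by (simp add: vec_eq_iff forall_4_from_0 matrix_matrix_mult_def matrix_vector_mult_def
      sum_4_from_0 sum_3 block_matrix_def)

lemma block_matrix_eq_0_iff: "block_matrix b A = 0 \<longleftrightarrow> b = 0 \<and> A = 0"
  by (auto simp: vec_eq_iff forall_4_from_0 forall_3 block_matrix_def)

lemma ex_block_matrix_iff: "(\<exists>A b. M = block_matrix b A) \<longleftrightarrow> M $ 0 = 0"
proof
  show "M $ 0 = 0" if "\<exists>A b. M = block_matrix b A"
    using that by (auto simp: vec_eq_iff block_matrix_def)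
  \<comment> \<open>\<open>emb\<close> inverts \<open>imag_index\<close> on the nonzero indices and
    so reads off the lower blocks of \<open>M\<close>.\<close>
  define emb :: "3 \<Rightarrow> 4" where "emb i = (if i = 1 then 1 else if i = 2 then 2 else 3)" for i
  have [simp]: "emb 1 = 1" "emb 2 = 2" "emb 3 = 3"
    by (simp_all add: emb_def)
  show "\<exists>A b. M = block_matrix b A" if "M $ 0 = 0"
  proof (intro exI)
    show "M = block_matrix (\<chi> i. M $ emb i $ 0) (\<chi> i j. M $ emb i $ emb j)"
      using that by (simp add: vec_eq_iff forall_4_from_0 block_matrix_def)
  qed
qed

theorem theorem4p1:
  fixes R :: "dual_quaternion \<Rightarrow> dual_quaternion"
  assumes "linear R"
  shows "rota_baxter_operator 0 R \<longleftrightarrow>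
    (\<exists>(A :: real ^ 3 ^ 3) (b :: real ^ 3).
      dq_matrix R = block_matrix b A \<and> A ** A = 0 \<and> A *v b = 0)"
proof -
  have "rota_baxter_operator 0 R \<longleftrightarrow>
      dq_matrix R $ 0 = 0 \<and> dq_matrix R ** dq_matrix R = 0"
    by (simp only: rota_baxter_0_iff dq_re_eq_0_iff_row square_eq_0_iff_matrix assms)
  also have "\<dots> \<longleftrightarrow> (\<exists>A b. dq_matrix R = block_matrix b A \<and>
      block_matrix b A ** block_matrix b A = 0)"
    unfolding ex_block_matrix_iff[symmetric] by metis
  finally show ?thesis
    by (auto simp: block_matrix_mult block_matrix_eq_0_iff)
qed

end
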